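(* Let $n\ge 2$ be an integer and let $\theta_1=(\theta_{1,0},\dots,\theta_{1,n})^T\in\mathbb{R}^{n+1}$ be fixed with $\theta_{1,n}\neq0$. Suppose that $b=\theta_{1,n-1}/\theta_{1,n}$ satisfies $b\neq 0$ and $$|b|\le n\,\frac{1-\cos(\pi/n)}{1+\cos(\pi/n)}=n\tan^2\left(\frac{\pi}{2n}\right).$$ Put $$t_i^*(b)=-\left(1+\frac{|b|}{n}\right)\cos\left(\frac{i\pi}{n}\right)-\frac{|b|}{n},\qquad i=1,\dots,n,$$ and $$\omega_i^*=\frac{2}{n}\sin^2\left(\frac{i\pi}{2n}\right),\qquad \omega_{n-i}^*=\frac{2}{n}\cos^2\left(\frac{i\pi}{2n}\right)\qquad \left(i=1,\dots,\left\lfloor \tfrac n2\right\rfloor\right),\qquad \omega_n^*=\frac1n .$$ Then there exists a unique $T$-optimal design on $[-1,1]$ for discriminating between the models $\eta_1(x,\theta_1)=\sum_{j=0}^{n}\theta_{1,j}x^j$ and $\eta_2(x,\theta_2)=\sum_{j=0}^{n-2}\theta_{2,j}x^j$. If $b>0$, this design has mass $\omega_i^*$ at the point $t_i^*(b)$, $i=1,\dots,n$. If $b<0$, this design has mass $\omega_i^*$ at the point $-t_i^*(b)$, $i=1,\dots,n$.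
   Context: A design on $[-1,1]$ is a probability measure on $[-1,1]$ with finite support. For a fixed parameter $\theta_1$, a design $\xi^*$ is called $T$-optimal for discriminating between $\eta_1(x,\theta_1)$ and $\eta_2(x,\theta_2)$ if it maximizes, over all designs $\xi$ on $[-1,1]$, the quantity $$\min_{\theta_2\in\mathbb{R}^{n-1}}\int_{[-1,1]}\bigl(\eta_1(x,\theta_1)-\eta_2(x,\theta_2)\bigr)^2\,\xi(dx),$$ where $\theta_2=(\theta_{2,0},\dots,\theta_{2,n-2})^T$. *)

theory Defs
  imports "HOL-Probability.Probability"
begin

text \<open>
  A probability measure with finite support is represented by a \<open>pmf\<close> with finite \<open>set_pmf\<close>,
  which is then exactly its support.
\<close>

definition is_design :: "real set \<Rightarrow> real pmf \<Rightarrow> bool" where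
  "is_design X \<xi> \<longleftrightarrow> finite (set_pmf \<xi>) \<and> set_pmf \<xi> \<subseteq> X"

text \<open>
  The minimum over the parameter space is written as an infimum; for the polynomial models used
  here it is attained, see \<open>T_criterion_poly_attained\<close> below.
\<close>

definition T_criterion ::
    "(real \<Rightarrow> 'a \<Rightarrow> real) \<Rightarrow> 'a \<Rightarrow> (real \<Rightarrow> 'b \<Rightarrow> real) \<Rightarrow> 'b set \<Rightarrow> real pmf \<Rightarrow> real" where
  "T_criterion \<eta>\<^sub>1 \<theta>\<^sub>1 \<eta>\<^sub>2 \<Theta>\<^sub>2 \<xi> =
     (INF \<theta>\<^sub>2\<in>\<Theta>\<^sub>2. measure_pmf.expectation \<xi> (\<lambda>x. (\<eta>\<^sub>1 x \<theta>\<^sub>1 - \<eta>\<^sub>2 x \<theta>\<^sub>2)\<^sup>2))"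

definition T_optimal ::
    "real set \<Rightarrow> (real \<Rightarrow> 'a \<Rightarrow> real) \<Rightarrow> 'a \<Rightarrow> (real \<Rightarrow> 'b \<Rightarrow> real) \<Rightarrow> 'b set \<Rightarrow> real pmf \<Rightarrow> bool" where
  "T_optimal X \<eta>\<^sub>1 \<theta>\<^sub>1 \<eta>\<^sub>2 \<Theta>\<^sub>2 \<xi> \<longleftrightarrow>
     is_design X \<xi> \<and>
     (\<forall>\<zeta>. is_design X \<zeta> \<longrightarrow> T_criterion \<eta>\<^sub>1 \<theta>\<^sub>1 \<eta>\<^sub>2 \<Theta>\<^sub>2 \<zeta> \<le> T_criterion \<eta>\<^sub>1 \<theta>\<^sub>1 \<eta>\<^sub>2 \<Theta>\<^sub>2 \<xi>)"

text \<open>Coefficient vectors \<open>(\<theta>\<^sub>0, \<dots>, \<theta>\<^sub>m)\<close>, i.e. a copy of the (\<open>m + 1\<close>)-dimensional real space.\<close>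

definition coeff_space :: "nat \<Rightarrow> (nat \<Rightarrow> real) set" where
  "coeff_space m = {0..m} \<rightarrow>\<^sub>E UNIV"

definition poly_model :: "nat \<Rightarrow> real \<Rightarrow> (nat \<Rightarrow> real) \<Rightarrow> real" where
  "poly_model m x \<theta> = (\<Sum>j=0..m. \<theta> j * x ^ j)"

definition tstar :: "nat \<Rightarrow> real \<Rightarrow> nat \<Rightarrow> real" where
  "tstar n b i = - (1 + \<bar>b\<bar> / real n) * cos (real i * pi / real n) - \<bar>b\<bar> / real n"

definition omegastar :: "nat \<Rightarrow> nat \<Rightarrow> real" where
  "omegastar n i =
     (if i = n then 1 / real n
      else if i \<le> n div 2 then 2 / real n * (sin (real i * pi / (2 * real n)))\<^sup>2
      else 2 / real n * (cos (real (n - i) * pi / (2 * real n)))\<^sup>2)"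

text \<open>
  For even \<open>n\<close> the index \<open>i = n / 2\<close> occurs in both families of weights; the two prescriptions agree.
\<close>

lemma omegastar_eqs:
  assumes "n \<ge> 2"
  shows "\<And>i. i \<in> {1..n div 2} \<Longrightarrow> omegastar n i = 2 / real n * (sin (real i * pi / (2 * real n)))\<^sup>2"
    and "\<And>i. i \<in> {1..n div 2} \<Longrightarrow> omegastar n (n - i) = 2 / real n * (cos (real i * pi / (2 * real n)))\<^sup>2"
    and "omegastar n n = 1 / real n"
proof -
  fix i assume i: "i \<in> {1..n div 2}"
  show "omegastar n i = 2 / real n * (sin (real i * pi / (2 * real n)))\<^sup>2"
    using i assms by (auto simp: omegastar_def)
  show "omegastar n (n - i) = 2 / real n * (cos (real i * pi / (2 * real n)))\<^sup>2"
  proof (cases "n - i \<le> n div 2")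
    case True
    then have n: "n = 2 * i" using i by auto
    have "real i * pi / (2 * real n) = pi / 4" using n i by (simp add: field_simps)
    then show ?thesis using i n by (simp add: omegastar_def sin_45 cos_45)
  next
    case False
    then show ?thesis using i assms by (auto simp: omegastar_def of_nat_diff)
  qed
next
  show "omegastar n n = 1 / real n" by (simp add: omegastar_def)
qed

lemma weighted_projection_exists:
  fixes w :: "'a \<Rightarrow> real" and g :: "nat \<Rightarrow> 'a \<Rightarrow> real"
  assumes fin: "finite S" and w: "\<And>x. x \<in> S \<Longrightarrow> w x \<ge> 0"
  shows "\<exists>c. \<forall>i<k. (\<Sum>x\<in>S. w x * (f x - (\<Sum>j<k. c j * g j x)) * g i x) = 0"
proof (induction k arbitrary: f)
  case 0
  then show ?case by simp
next
  case (Suc k)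
  obtain a where a: "\<And>i. i < k \<Longrightarrow> (\<Sum>x\<in>S. w x * (f x - (\<Sum>j<k. a j * g j x)) * g i x) = 0"
    using Suc.IH by blast
  obtain d where d: "\<And>i. i < k \<Longrightarrow> (\<Sum>x\<in>S. w x * (g k x - (\<Sum>j<k. d j * g j x)) * g i x) = 0"
    using Suc.IH by blast
  define r where "r x = f x - (\<Sum>j<k. a j * g j x)" for x
  define s where "s x = g k x - (\<Sum>j<k. d j * g j x)" for x
  define ip where "ip u v = (\<Sum>x\<in>S. w x * u x * v x)" for u v
  have r0: "ip r (g i) = 0" and s0: "ip s (g i) = 0" if "i < k" for i
    using a[OF that] d[OF that] by (simp_all add: ip_def r_def s_def)
  have gk: "ip u (g k) = ip u s" if "\<And>i. i < k \<Longrightarrow> ip u (g i) = 0" for u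
  proof -
    have "ip u (g k) = ip u (\<lambda>x. s x + (\<Sum>j<k. d j * g j x))" by (simp add: s_def)
    also have "\<dots> = ip u s + (\<Sum>x\<in>S. \<Sum>j<k. d j * (w x * u x * g j x))"
      by (simp add: ip_def distrib_left sum.distrib sum_distrib_left mult_ac)
    also have "(\<Sum>x\<in>S. \<Sum>j<k. d j * (w x * u x * g j x)) = (\<Sum>j<k. d j * ip u (g j))"
      by (subst sum.swap) (simp add: ip_def sum_distrib_left)
    also have "\<dots> = 0" using that by simp
    finally show ?thesis by simp
  qed
  have deg: "ip r (g k) = 0" if "ip s (g k) = 0"
  proof -
    have "(\<Sum>x\<in>S. w x * s x * s x) = 0" using gk[of s] s0 that by (simp add: ip_def)
    then have "\<forall>x\<in>S. w x * s x * s x = 0"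
      using fin w by (subst (asm) sum_nonneg_eq_0_iff) (auto simp: mult.assoc)
    then have "ip r s = 0" by (auto simp: ip_def intro!: sum.neutral)
    then show ?thesis using gk[of r] r0 by simp
  qed
  define l where "l = ip r (g k) / ip s (g k)"
  define c where "c j = (if j = k then l else a j - l * d j)" for j
  have res: "f x - (\<Sum>j<Suc k. c j * g j x) = r x - l * s x" for x
    by (simp add: c_def r_def s_def algebra_simps sum_subtractf sum_distrib_left)
  have lin: "ip (\<lambda>x. r x - l * s x) v = ip r v - l * ip s v" for v
    by (simp add: ip_def algebra_simps sum_subtractf sum_distrib_left)
  have "ip (\<lambda>x. r x - l * s x) (g i) = 0" if "i < Suc k" for i
  proof (cases "i = k")
    case True
    then show ?thesis using deg unfolding lin by (cases "ip s (g k) = 0") (auto simp: l_def)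
  next
    case False
    then have "i < k" using that by simp
    then show ?thesis using r0 s0 unfolding lin by simp
  qed
  then show ?case by (intro exI[of _ c]) (simp only: res ip_def, simp)
qed

lemma T_criterion_poly_attained:
  assumes fin: "finite (set_pmf \<xi>)"
  shows "\<exists>\<theta>\<^sub>2 \<in> coeff_space m. T_criterion \<eta>\<^sub>1 \<theta>\<^sub>1 (poly_model m) (coeff_space m) \<xi>
           = measure_pmf.expectation \<xi> (\<lambda>x. (\<eta>\<^sub>1 x \<theta>\<^sub>1 - poly_model m x \<theta>\<^sub>2)\<^sup>2)"
proof -
  let ?S = "set_pmf \<xi>"
  let ?E = "\<lambda>\<theta>. measure_pmf.expectation \<xi> (\<lambda>x. (\<eta>\<^sub>1 x \<theta>\<^sub>1 - poly_model m x \<theta>)\<^sup>2)"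
  have E: "?E \<theta> = (\<Sum>x\<in>?S. pmf \<xi> x * (\<eta>\<^sub>1 x \<theta>\<^sub>1 - poly_model m x \<theta>)\<^sup>2)" for \<theta>
    by (subst integral_measure_pmf[OF fin]) auto
  have pm: "poly_model m x \<theta> = (\<Sum>j<Suc m. \<theta> j * x ^ j)" for x \<theta>
    by (simp add: poly_model_def atLeast0AtMost lessThan_Suc_atMost)
  obtain c0 where c0: "\<And>i. i < Suc m \<Longrightarrow>
      (\<Sum>x\<in>?S. pmf \<xi> x * (\<eta>\<^sub>1 x \<theta>\<^sub>1 - poly_model m x c0) * x ^ i) = 0"
    using weighted_projection_exists[OF fin, of "pmf \<xi>" "Suc m" "\<lambda>x. \<eta>\<^sub>1 x \<theta>\<^sub>1" "\<lambda>j x. x ^ j"]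
    unfolding pm by auto
  define c where "c = restrict c0 {0..m}"
  have cc: "poly_model m x c = poly_model m x c0" for x
    by (simp add: poly_model_def c_def)
  have "c \<in> coeff_space m" by (auto simp: c_def coeff_space_def)
  moreover have "?E c \<le> ?E \<theta>" for \<theta>
  proof -
    define r where "r x = \<eta>\<^sub>1 x \<theta>\<^sub>1 - poly_model m x c0" for x
    define p where "p x = poly_model m x c0 - poly_model m x \<theta>" for x
    have "(\<Sum>x\<in>?S. pmf \<xi> x * r x * p x)
        = (\<Sum>x\<in>?S. \<Sum>j<Suc m. (c0 j - \<theta> j) * (pmf \<xi> x * r x * x ^ j))"
      unfolding p_def pm sum_subtractf[symmetric] sum_distrib_left
      by (intro sum.cong refl) (simp add: algebra_simps)
    also have "\<dots> = (\<Sum>j<Suc m. (c0 j - \<theta> j) * (\<Sum>x\<in>?S. pmf \<xi> x * r x * x ^ j))"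
      by (subst sum.swap) (simp add: sum_distrib_left)
    also have "\<dots> = 0" using c0 by (intro sum.neutral) (simp add: r_def)
    finally have orth: "(\<Sum>x\<in>?S. pmf \<xi> x * r x * p x) = 0" .
    have "?E \<theta> = (\<Sum>x\<in>?S. pmf \<xi> x * (r x)\<^sup>2 + 2 * (pmf \<xi> x * r x * p x) + pmf \<xi> x * (p x)\<^sup>2)"
      unfolding E by (intro sum.cong refl) (simp add: r_def p_def power2_eq_square algebra_simps)
    also have "\<dots> = ?E c + (\<Sum>x\<in>?S. pmf \<xi> x * (p x)\<^sup>2)"
      unfolding E cc using orth by (simp add: sum.distrib sum_distrib_left[symmetric] r_def)
    finally show ?thesis by (simp add: sum_nonneg)
  qed
  ultimately show ?thesis
    unfolding T_criterion_def by (intro bexI[of _ c] cInf_eq_minimum) auto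
qed

end

theory Submission
  imports Defs
begin

text \<open>
  Let \<open>\<beta> = \<bar>b\<bar> / n\<close> and \<open>u x = (sgn b * x + \<beta>) / (1 + \<beta>)\<close>. Since \<open>T\<^sub>n\<close> has no term of degree \<open>n - 1\<close>,
  the polynomial \<open>T\<^sub>n (u x)\<close> has the two top coefficients in ratio \<open>b\<close>, so a multiple \<open>P\<close> of it is a
  residual \<open>\<eta>\<^sub>1 - \<eta>\<^sub>2\<close>. As \<open>u\<close> maps \<open>[-1, 1]\<close> into itself, \<open>P\<^sup>2\<close> is bounded there by a constant \<open>K\<close>, and
  the bound on \<open>b\<close> says that the points \<open>\<plusminus>t\<^sub>i\<^sup>*\<close> where \<open>P\<^sup>2 = K\<close> lie in \<open>[-1, 1]\<close> for all
  \<open>i = 1, \<dots>, n\<close>; the one for \<open>i = 0\<close> does not, because \<open>b \<noteq> 0\<close>. The criterion is therefore at most \<open>K\<close>, with equality iff the design lives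
  on these points and \<open>P\<close> is orthogonal to all polynomials of degree at most \<open>n - 2\<close>. The discrete
  orthogonality of the cosines gives this for the weights \<open>\<omega>\<^sub>i\<^sup>*\<close>. Testing with products of \<open>n - 2\<close> of the
  linear factors shows that on \<open>n\<close> points such weights are unique up to scaling.
\<close>

section \<open>Duality\<close>

lemma poly_eq_poly_model:
  assumes "degree p \<le> m"
  shows "poly p x = poly_model m x (restrict (coeff p) {0..m})"
proof -
  have "poly p x = (\<Sum>j\<le>degree p. coeff p j * x ^ j)"
    by (rule poly_altdef)
  also have "\<dots> = (\<Sum>j\<le>m. coeff p j * x ^ j)"
    using assms by (intro sum.mono_neutral_left) (auto simp: coeff_eq_0)
  finally show ?thesis
    by (simp add: poly_model_def atLeast0AtMost)
qed

lemma poly_model_as_poly: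
  obtains p where "degree p \<le> m" "\<And>x. poly_model m x \<theta> = poly p x" "\<And>j. j \<le> m \<Longrightarrow> coeff p j = \<theta> j"
proof
  let ?p = "\<Sum>j=0..m. monom (\<theta> j) j"
  show "degree ?p \<le> m"
    by (intro degree_sum_le) (auto intro: order_trans[OF degree_monom_le])
  show "poly_model m x \<theta> = poly ?p x" for x
    by (simp add: poly_model_def poly_sum poly_monom)
  show "coeff ?p j = \<theta> j" if "j \<le> m" for j
    using that by (simp add: coeff_sum)
qed

lemma T_criterion_le:
  assumes "\<theta> \<in> \<Theta>\<^sub>2"
  shows "T_criterion \<eta>\<^sub>1 \<theta>\<^sub>1 \<eta>\<^sub>2 \<Theta>\<^sub>2 \<xi> \<le> measure_pmf.expectation \<xi> (\<lambda>x. (\<eta>\<^sub>1 x \<theta>\<^sub>1 - \<eta>\<^sub>2 x \<theta>)\<^sup>2)"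
  unfolding T_criterion_def using assms
  by (intro cINF_lower bdd_belowI2[where m = 0]) auto

lemma T_criterion_ge:
  assumes "\<Theta>\<^sub>2 \<noteq> {}"
    and "\<And>\<theta>. \<theta> \<in> \<Theta>\<^sub>2 \<Longrightarrow> K \<le> measure_pmf.expectation \<xi> (\<lambda>x. (\<eta>\<^sub>1 x \<theta>\<^sub>1 - \<eta>\<^sub>2 x \<theta>)\<^sup>2)"
  shows "K \<le> T_criterion \<eta>\<^sub>1 \<theta>\<^sub>1 \<eta>\<^sub>2 \<Theta>\<^sub>2 \<xi>"
  unfolding T_criterion_def using assms by (intro cINF_greatest) auto

text \<open>These are the equality conditions of the duality. When \<open>r\<^sup>2\<close> is at
  most \<open>K\<close> on the design space, the first maximises the expected squared residual; the
  second is the system of normal equations, which makes \<open>r\<close> a least-squares residual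
  for the design.\<close>

definition equioscillating :: "nat \<Rightarrow> (real \<Rightarrow> real) \<Rightarrow> real \<Rightarrow> real pmf \<Rightarrow> bool" where
  "equioscillating m r K \<xi> \<longleftrightarrow>
     (\<forall>x\<in>set_pmf \<xi>. (r x)\<^sup>2 = K) \<and>
     (\<forall>p. degree p \<le> m \<longrightarrow> measure_pmf.expectation \<xi> (\<lambda>x. r x * poly p x) = 0)"

lemma expectation_square_add:
  fixes r q :: "'a \<Rightarrow> real"
  assumes "finite (set_pmf \<xi>)"
  shows "measure_pmf.expectation \<xi> (\<lambda>x. (r x + s * q x)\<^sup>2)
       = measure_pmf.expectation \<xi> (\<lambda>x. (r x)\<^sup>2)
         + 2 * s * measure_pmf.expectation \<xi> (\<lambda>x. r x * q x)
         + s\<^sup>2 * measure_pmf.expectation \<xi> (\<lambda>x. (q x)\<^sup>2)"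
proof -
  have "(\<lambda>x. (r x + s * q x)\<^sup>2) = (\<lambda>x. (r x)\<^sup>2 + 2 * s * (r x * q x) + s\<^sup>2 * (q x)\<^sup>2)"
    by (simp add: fun_eq_iff power2_eq_square algebra_simps)
  then show ?thesis
    by (simp add: integrable_measure_pmf_finite[OF assms])
qed

lemma linear_coeff_eq_0_if_quadratic_nonneg:
  fixes A B :: real
  assumes "B \<ge> 0" and "\<And>s. 0 \<le> 2 * s * A + s\<^sup>2 * B"
  shows "A = 0"
proof -
  \<comment> \<open>The minimiser would be \<open>- A / B\<close>; the denominator
    \<open>B + 1\<close> also covers \<open>B = 0\<close> and still makes the value negative unless
    \<open>A = 0\<close>.\<close>
  have "0 \<le> 2 * (- A / (B + 1)) * A + (- A / (B + 1))\<^sup>2 * B"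
    by (rule assms)
  also have "\<dots> = - (A\<^sup>2 * (B + 2) / (B + 1)\<^sup>2)"
    using \<open>B \<ge> 0\<close> by (simp add: divide_simps) (simp add: power2_eq_square algebra_simps)
  finally have "A\<^sup>2 * (B + 2) / (B + 1)\<^sup>2 \<le> 0" by simp
  then have "A\<^sup>2 * (B + 2) \<le> 0"
    using \<open>B \<ge> 0\<close> by (simp add: divide_le_0_iff)
  then show ?thesis
    using \<open>B \<ge> 0\<close> by (auto simp: mult_le_0_iff)
qed

text \<open>Every design satisfies \<open>T \<le> E r\<^sup>2 \<le> K\<close>. The design
  \<open>\<xi>\<^sub>0\<close> attains \<open>K\<close>, so for an optimal design both inequalities
  become equalities: the right one yields the support condition, the left one the
  orthogonality.\<close>

lemma T_optimal_iff_equioscillating: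
  assumes r: "\<And>x. r x = \<eta>\<^sub>1 x \<theta>\<^sub>1 - poly_model m x \<theta>\<^sub>0" and \<theta>\<^sub>0: "\<theta>\<^sub>0 \<in> coeff_space m"
    and bound: "\<And>x. x \<in> X \<Longrightarrow> (r x)\<^sup>2 \<le> K"
    and \<xi>\<^sub>0: "is_design X \<xi>\<^sub>0" "equioscillating m r K \<xi>\<^sub>0"
  shows "T_optimal X \<eta>\<^sub>1 \<theta>\<^sub>1 (poly_model m) (coeff_space m) \<xi>
           \<longleftrightarrow> is_design X \<xi> \<and> equioscillating m r K \<xi>"
proof -
  let ?T = "T_criterion \<eta>\<^sub>1 \<theta>\<^sub>1 (poly_model m) (coeff_space m)"
  let ?E = "\<lambda>\<xi>. measure_pmf.expectation \<xi>"
  have T_le: "?T \<zeta> \<le> ?E \<zeta> (\<lambda>x. (r x)\<^sup>2)" for \<zeta>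
    unfolding r by (rule T_criterion_le[OF \<theta>\<^sub>0])
  have E_le: "?E \<zeta> (\<lambda>x. (r x)\<^sup>2) \<le> K" if "is_design X \<zeta>" for \<zeta>
  proof -
    have "?E \<zeta> (\<lambda>x. (r x)\<^sup>2) \<le> ?E \<zeta> (\<lambda>x. K)"
      using that bound unfolding is_design_def
      by (intro integral_mono_AE) (auto simp: integrable_measure_pmf_finite AE_measure_pmf_iff)
    then show ?thesis by simp
  qed
  \<comment> \<open>Pythagoras: any other residual is \<open>r\<close> plus a polynomial of degree
    at most \<open>m\<close>, and the cross term vanishes by orthogonality.\<close>
  have K_le: "K \<le> ?T \<zeta>" if "is_design X \<zeta>" "equioscillating m r K \<zeta>" for \<zeta>
  proof (rule T_criterion_ge)
    show "coeff_space m \<noteq> {}" using \<theta>\<^sub>0 by auto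
    fix \<theta> assume "\<theta> \<in> coeff_space m"
    obtain p where p: "degree p \<le> m" "\<And>x. poly_model m x \<theta>\<^sub>0 = poly p x"
      using poly_model_as_poly by blast
    obtain q where q: "degree q \<le> m" "\<And>x. poly_model m x \<theta> = poly q x"
      using poly_model_as_poly by blast
    have fin: "finite (set_pmf \<zeta>)" using that(1) by (simp add: is_design_def)
    have "?E \<zeta> (\<lambda>x. (r x)\<^sup>2) = ?E \<zeta> (\<lambda>x. K)"
      using that(2) unfolding equioscillating_def
      by (intro integral_cong_AE) (auto simp: AE_measure_pmf_iff)
    then have K: "?E \<zeta> (\<lambda>x. (r x)\<^sup>2) = K" by simp
    have orth: "?E \<zeta> (\<lambda>x. r x * poly (p - q) x) = 0"
      using that(2) p(1) q(1) degree_diff_le unfolding equioscillating_def by blast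
    have "(\<lambda>x. (\<eta>\<^sub>1 x \<theta>\<^sub>1 - poly_model m x \<theta>)\<^sup>2) = (\<lambda>x. (r x + 1 * poly (p - q) x)\<^sup>2)"
      by (simp add: fun_eq_iff r p q)
    then have "?E \<zeta> (\<lambda>x. (\<eta>\<^sub>1 x \<theta>\<^sub>1 - poly_model m x \<theta>)\<^sup>2) = K + ?E \<zeta> (\<lambda>x. (poly (p - q) x)\<^sup>2)"
      using expectation_square_add[OF fin, of r 1 "poly (p - q)"] K orth by simp
    then show "K \<le> ?E \<zeta> (\<lambda>x. (\<eta>\<^sub>1 x \<theta>\<^sub>1 - poly_model m x \<theta>)\<^sup>2)" by simp
  qed
  show ?thesis
  proof
    assume "T_optimal X \<eta>\<^sub>1 \<theta>\<^sub>1 (poly_model m) (coeff_space m) \<xi>"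
    then have des: "is_design X \<xi>" and "?T \<xi>\<^sub>0 \<le> ?T \<xi>"
      using \<xi>\<^sub>0(1) by (auto simp: T_optimal_def)
    then have KT: "K \<le> ?T \<xi>" using K_le[OF \<xi>\<^sub>0] by simp
    have fin: "finite (set_pmf \<xi>)" and sub: "set_pmf \<xi> \<subseteq> X"
      using des by (auto simp: is_design_def)
    have EK: "?E \<xi> (\<lambda>x. (r x)\<^sup>2) = K"
      using KT T_le[of \<xi>] E_le[OF des] by simp
    have "?E \<xi> (\<lambda>x. K - (r x)\<^sup>2) = 0"
      using EK by (simp add: integrable_measure_pmf_finite[OF fin])
    then have "AE x in \<xi>. K - (r x)\<^sup>2 = 0"
      using sub bound
      by (subst (asm) integral_nonneg_eq_0_iff_AE)
         (auto simp: integrable_measure_pmf_finite[OF fin] AE_measure_pmf_iff)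
    then have "\<forall>x\<in>set_pmf \<xi>. (r x)\<^sup>2 = K" by (simp add: AE_measure_pmf_iff)
    \<comment> \<open>First variation: each \<open>r + s * p\<close> is again a residual, so its
      expected square cannot fall below \<open>K\<close>, its value at \<open>s = 0\<close>.\<close>
    moreover have "?E \<xi> (\<lambda>x. r x * poly p x) = 0" if p: "degree p \<le> m" for p
    proof (rule linear_coeff_eq_0_if_quadratic_nonneg)
      show "0 \<le> ?E \<xi> (\<lambda>x. (poly p x)\<^sup>2)" by simp
      fix s
      obtain q where q: "degree q \<le> m" "\<And>x. poly_model m x \<theta>\<^sub>0 = poly q x"
        using poly_model_as_poly by blast
      let ?\<theta> = "restrict (coeff (q - smult s p)) {0..m}"
      have "degree (q - smult s p) \<le> m"
        using p q(1) by (intro degree_diff_le) (auto intro: order_trans[OF degree_smult_le])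
      from poly_eq_poly_model[OF this]
      have model: "poly_model m x ?\<theta> = poly_model m x \<theta>\<^sub>0 - s * poly p x" for x
        by (simp add: q)
      then have "(\<lambda>x. (\<eta>\<^sub>1 x \<theta>\<^sub>1 - poly_model m x ?\<theta>)\<^sup>2) = (\<lambda>x. (r x + s * poly p x)\<^sup>2)"
        by (simp add: fun_eq_iff r model algebra_simps)
      moreover have "?\<theta> \<in> coeff_space m" by (auto simp: coeff_space_def)
      ultimately have "K \<le> ?E \<xi> (\<lambda>x. (r x + s * poly p x)\<^sup>2)"
        using KT T_criterion_le[of ?\<theta> "coeff_space m" \<eta>\<^sub>1 \<theta>\<^sub>1 "poly_model m" \<xi>] by simp
      then show "0 \<le> 2 * s * ?E \<xi> (\<lambda>x. r x * poly p x) + s\<^sup>2 * ?E \<xi> (\<lambda>x. (poly p x)\<^sup>2)"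
        using expectation_square_add[OF fin, of r s "poly p"] EK by simp
    qed
    ultimately show "is_design X \<xi> \<and> equioscillating m r K \<xi>"
      using des by (simp add: equioscillating_def)
  next
    assume *: "is_design X \<xi> \<and> equioscillating m r K \<xi>"
    have "?T \<zeta> \<le> ?T \<xi>" if "is_design X \<zeta>" for \<zeta>
      using T_le[of \<zeta>] E_le[OF that] K_le[of \<xi>] * by simp
    then show "T_optimal X \<eta>\<^sub>1 \<theta>\<^sub>1 (poly_model m) (coeff_space m) \<xi>"
      using * by (simp add: T_optimal_def)
  qed
qed

section \<open>Uniqueness of annihilating weights\<close>

text \<open>A product of linear factors vanishing at the other \<open>m\<close> points leaves one
  relation between the weights at \<open>x\<close> and \<open>z\<close>, with the same coefficients
  for \<open>w\<close> and \<open>v\<close>. The cross-multiplied form avoids dividing by a weight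
  that may be zero.\<close>

lemma annihilating_weights_proportional:
  fixes w v :: "real \<Rightarrow> real"
  assumes A: "finite A" "card A = m + 2" "x \<in> A" "z \<in> A"
    and w: "\<And>p. degree p \<le> m \<Longrightarrow> (\<Sum>y\<in>A. w y * poly p y) = 0"
    and v: "\<And>p. degree p \<le> m \<Longrightarrow> (\<Sum>y\<in>A. v y * poly p y) = 0"
  shows "w x * v z = w z * v x"
proof (cases "x = z")
  case False
  define q :: "real poly" where "q = (\<Prod>y\<in>A - {x, z}. [:- y, 1:])"
  have "card (A - {x, z}) = m"
    using A False by (simp add: card_Diff_subset)
  then have deg: "degree q \<le> m"
    unfolding q_def using degree_prod_sum_le[of "A - {x,z}" "\<lambda>y. [:- y, 1:]"] A by simp
  have split: "(\<Sum>y\<in>A. u y * poly q y) = u x * poly q x + u z * poly q z" for u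
  proof -
    have "poly q y = 0" if "y \<in> A - {x, z}" for y
      using that A(1) by (auto simp: q_def poly_prod)
    then have "(\<Sum>y\<in>A. u y * poly q y) = (\<Sum>y\<in>{x, z}. u y * poly q y)"
      using A by (intro sum.mono_neutral_right) auto
    then show ?thesis using False by simp
  qed
  have "w x * poly q x + w z * poly q z = 0" "v x * poly q x + v z * poly q z = 0"
    using w[OF deg] v[OF deg] by (simp_all add: split)
  \<comment> \<open>Both sides equal \<open>- (w x * v x * poly q x)\<close>.\<close>
  then have "(w x * v z) * poly q z = (w z * v x) * poly q z"
    by algebra
  moreover have "poly q z \<noteq> 0"
    using A(1) by (auto simp: q_def poly_prod)
  ultimately show ?thesis by simp
qed simp

text \<open>The products \<open>pmf * r\<close> annihilate the polynomials of degree at most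
  \<open>m\<close> on \<open>m + 2\<close> points, hence are proportional. The nonzero values of
  \<open>r\<close> cancel, and total mass 1 fixes the scale.\<close>

lemma equioscillating_unique:
  assumes A: "finite A" "card A = m + 2" "set_pmf \<xi> \<subseteq> A" "set_pmf \<zeta> \<subseteq> A"
    and r: "\<And>x. x \<in> A \<Longrightarrow> r x \<noteq> 0"
    and eq: "equioscillating m r K \<xi>" "equioscillating m r K \<zeta>"
  shows "\<xi> = \<zeta>"
proof -
  have sum1: "(\<Sum>x\<in>A. pmf \<rho> x) = 1" if "set_pmf \<rho> \<subseteq> A" for \<rho>
    using that A(1) by (intro sum_pmf_eq_1) auto
  have orth: "(\<Sum>x\<in>A. pmf \<rho> x * r x * poly p x) = 0"
    if "set_pmf \<rho> \<subseteq> A" "equioscillating m r K \<rho>" "degree p \<le> m" for \<rho> p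
  proof -
    have "measure_pmf.expectation \<rho> (\<lambda>x. r x * poly p x) = (\<Sum>x\<in>A. pmf \<rho> x *\<^sub>R (r x * poly p x))"
      using that(1) A(1) by (intro integral_measure_pmf) auto
    then show ?thesis using that(2,3) by (simp add: equioscillating_def mult.assoc)
  qed
  have proportional: "pmf \<xi> x * pmf \<zeta> z = pmf \<xi> z * pmf \<zeta> x" if "x \<in> A" "z \<in> A" for x z
  proof -
    have "(pmf \<xi> x * r x) * (pmf \<zeta> z * r z) = (pmf \<xi> z * r z) * (pmf \<zeta> x * r x)"
      using that A eq
      by (intro annihilating_weights_proportional[OF A(1,2)] orth) auto
    then show ?thesis using r[OF that(1)] r[OF that(2)] by simp
  qed
  have "pmf \<xi> z = pmf \<zeta> z" if "z \<in> A" for z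
  proof -
    have "pmf \<zeta> z = (\<Sum>x\<in>A. pmf \<xi> x * pmf \<zeta> z)"
      by (simp add: sum1[OF A(3)] flip: sum_distrib_right)
    also have "\<dots> = (\<Sum>x\<in>A. pmf \<xi> z * pmf \<zeta> x)"
      using proportional that by (intro sum.cong) auto
    also have "\<dots> = pmf \<xi> z"
      by (simp add: sum1[OF A(4)] flip: sum_distrib_left)
    finally show ?thesis by simp
  qed
  moreover have "pmf \<xi> z = pmf \<zeta> z" if "z \<notin> A" for z
  proof -
    have "pmf \<xi> z = 0" "pmf \<zeta> z = 0"
      using that A(3,4) by (auto simp: set_pmf_iff)
    then show ?thesis by simp
  qed
  ultimately show ?thesis by (intro pmf_eqI) blast
qed

section \<open>Affinely transformed Chebyshev polynomials\<close>

text \<open>This is \<open>T_k\<close> composed with \<open>x \<mapsto> a * x + c\<close>. Having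
  the affine map inside the three-term recurrence lets its coefficients be found by
  induction.\<close>

fun affine_chebyshev :: "real \<Rightarrow> real \<Rightarrow> nat \<Rightarrow> real poly" where
  "affine_chebyshev a c 0 = 1"
| "affine_chebyshev a c (Suc 0) = [:c, a:]"
| "affine_chebyshev a c (Suc (Suc k)) =
     smult 2 ([:c, a:] * affine_chebyshev a c (Suc k)) - affine_chebyshev a c k"

lemma poly_affine_chebyshev:
  assumes "a * x + c = cos \<phi>"
  shows "poly (affine_chebyshev a c k) x = cos (real k * \<phi>)"
  using assms
proof (induction a c k rule: affine_chebyshev.induct)
  case (3 a c k)
  have "cos (real (Suc (Suc k)) * \<phi>) = 2 * cos \<phi> * cos (real (Suc k) * \<phi>) - cos (real k * \<phi>)"
    using cos_add[of "real (Suc k) * \<phi>" \<phi>] cos_diff[of "real (Suc k) * \<phi>" \<phi>]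
    by (simp add: algebra_simps)
  then show ?case using 3 by (simp flip: 3(3) add: algebra_simps)
qed (simp_all add: algebra_simps)

lemma degree_affine_chebyshev: "degree (affine_chebyshev a c k) \<le> k"
proof (induction a c k rule: affine_chebyshev.induct)
  case (3 a c k)
  have "degree ([:c, a:] * affine_chebyshev a c (Suc k)) \<le> 1 + Suc k"
    using 3 by (intro order_trans[OF degree_mult_le] add_mono) auto
  then show ?case
    using 3 by (auto intro!: degree_diff_le order_trans[OF degree_smult_le] simp del: mult_pCons_left)
qed auto

text \<open>Since \<open>T_(k+1)\<close> has no term of degree \<open>k\<close>, both coefficients
  come from expanding \<open>2 ^ k * (a * x + c) ^ (k + 1)\<close>. They are proved together because
  the recurrence for the lower one involves the upper one.\<close>

lemma coeff_affine_chebyshev: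
  "coeff (affine_chebyshev a c (Suc k)) (Suc k) = 2 ^ k * a ^ Suc k \<and>
   coeff (affine_chebyshev a c (Suc k)) k = 2 ^ k * real (Suc k) * c * a ^ k"
proof (induction k)
  case (Suc k)
  have "coeff ([:c, a:] * p) (Suc j) = c * coeff p (Suc j) + a * coeff p j" for p j
    by simp
  moreover have "coeff (affine_chebyshev a c k) (Suc k) = 0"
    "coeff (affine_chebyshev a c k) (Suc (Suc k)) = 0"
    "coeff (affine_chebyshev a c (Suc k)) (Suc (Suc k)) = 0"
    using degree_affine_chebyshev by (auto intro!: coeff_eq_0 simp: less_Suc_eq_le le_SucI)
  ultimately show ?case using Suc by (simp add: algebra_simps)
qed simp

section \<open>Discrete orthogonality of cosines\<close>

text \<open>
  The (doubled, unnormalised) trapezoidal sum of \<open>(-1)\<^sup>i f\<close>: the minus sign is the alternation between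
  neighbouring nodes. In this form the sum telescopes for cosines.
\<close>

definition alternating_trapezoid :: "nat \<Rightarrow> (real \<Rightarrow> real) \<Rightarrow> real" where
  "alternating_trapezoid n f =
     (\<Sum>i<n. (-1) ^ i * (f (real i * pi / real n) - f (real (Suc i) * pi / real n)))"

text \<open>Multiplication by \<open>cos (h / 2)\<close> turns the sum into a telescoping one whose
  end terms are multiples of \<open>sin (k * pi)\<close> and \<open>sin 0\<close>. The bound on
  \<open>k\<close> keeps that multiplier nonzero.\<close>

lemma alternating_trapezoid_cos:
  assumes "\<bar>k\<bar> < int n"
  shows "alternating_trapezoid n (\<lambda>x. cos (of_int k * x)) = 0"
proof -
  define h where "h = of_int k * pi / real n"
  define g where "g i = (-1) ^ i * sin (real i * h)" for i
  have n: "n > 0" using assms by simp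
  have "cos (h / 2) * ((-1) ^ i * (cos (real i * h) - cos (real (Suc i) * h)))
      = - sin (h / 2) * (g (Suc i) - g i)" for i
  proof -
    define y where "y = real i * h + h / 2"
    have i: "real i * h = y - h / 2" "real (Suc i) * h = y + h / 2"
      by (simp_all add: y_def algebra_simps)
    have "cos (h / 2) * (cos (y - h / 2) - cos (y + h / 2))
        = sin (h / 2) * (sin (y + h / 2) + sin (y - h / 2))"
      by (simp add: cos_add cos_diff sin_add sin_diff algebra_simps)
    then show ?thesis unfolding g_def i
      by (simp add: algebra_simps)
  qed
  then have "cos (h / 2) * (\<Sum>i<n. (-1) ^ i * (cos (real i * h) - cos (real (Suc i) * h)))
      = - sin (h / 2) * (\<Sum>i<n. g (Suc i) - g i)"
    by (simp add: sum_distrib_left)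
  also have "(\<Sum>i<n. g (Suc i) - g i) = 0"
    using n by (subst sum_lessThan_telescope) (simp add: g_def h_def mult.commute[of _ pi])
  finally have "cos (h / 2) * (\<Sum>i<n. (-1) ^ i * (cos (real i * h) - cos (real (Suc i) * h))) = 0"
    by simp
  moreover have "cos (h / 2) \<noteq> 0"
  proof -
    have "\<bar>h\<bar> < pi" 
      using assms n pi_gt_zero by (simp add: h_def abs_mult field_simps)
    then have "cos (h / 2) > 0" by (intro cos_gt_zero_pi) auto
    then show ?thesis by simp
  qed
  ultimately show ?thesis
    by (simp add: alternating_trapezoid_def h_def mult_ac)
qed

lemma alternating_trapezoid_lincomb:
  "alternating_trapezoid n (\<lambda>x. \<Sum>j\<in>J. c j * f j x) = (\<Sum>j\<in>J. c j * alternating_trapezoid n (f j))"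
  unfolding alternating_trapezoid_def sum_distrib_left
  by (subst sum.swap) (simp add: sum_distrib_left sum_subtractf algebra_simps)

text \<open>The factor \<open>cos (k * x)\<close> is there for the induction: the product-to-sum
  formula trades one power of \<open>cos x\<close> for a shift of \<open>k\<close> by one in either
  direction, which preserves the bound on \<open>j + \<bar>k\<bar>\<close>. Negative
  \<open>k\<close> can arise, hence the integer type.\<close>

lemma alternating_trapezoid_cos_power:
  assumes "int j + \<bar>k\<bar> < int n"
  shows "alternating_trapezoid n (\<lambda>x. cos x ^ j * cos (of_int k * x)) = 0"
  using assms
proof (induction j arbitrary: k)
  case 0
  then show ?case using alternating_trapezoid_cos by simp
next
  case (Suc j)
  have "cos x ^ Suc j * cos (of_int k * x)
      = (\<Sum>l\<in>{k + 1, k - 1}. 1 / 2 * (cos x ^ j * cos (of_int l * x)))" for x :: real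
    by (simp add: cos_add cos_diff field_simps)
  then have "alternating_trapezoid n (\<lambda>x. cos x ^ Suc j * cos (of_int k * x))
    = (\<Sum>l\<in>{k + 1, k - 1}. 1 / 2 * alternating_trapezoid n (\<lambda>x. cos x ^ j * cos (of_int l * x)))"
    by (simp only: alternating_trapezoid_lincomb)
  also have "\<dots> = 0"
    using Suc.IH[of "k + 1"] Suc.IH[of "k - 1"] Suc.prems by (intro sum.neutral) auto
  finally show ?case .
qed

lemma alternating_trapezoid_poly_cos:
  assumes "degree p < n"
  shows "alternating_trapezoid n (\<lambda>x. poly p (cos x)) = 0"
proof -
  have "alternating_trapezoid n (\<lambda>x. cos x ^ j) = 0" if "j \<le> degree p" for j
    using alternating_trapezoid_cos_power[of j 0 n] that assms by simp
  then show ?thesis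
    unfolding poly_altdef alternating_trapezoid_lincomb by (intro sum.neutral) simp
qed

section \<open>The optimal weights and support points\<close>

text \<open>
  The two families of weights are one: up to the factor \<open>1/2\<close> at \<open>i = n\<close>, they are the trapezoidal
  weights times \<open>1 - cos (i\<pi>/n)\<close>, a factor that vanishes at the excluded node \<open>i = 0\<close>.
\<close>

lemma omegastar_eq:
  assumes "1 \<le> i" "i \<le> n"
  shows "omegastar n i = (if i = n then 1 / 2 else 1) * (1 - cos (real i * pi / real n)) / real n"
proof -
  have 1: "1 - cos (2 * y) = 2 * (sin y)\<^sup>2" for y :: real
    by (simp add: cos_double_sin)
  have 2: "1 - cos (real i * pi / real n) = 2 * (sin (real i * pi / (2 * real n)))\<^sup>2"
    using 1[of "real i * pi / (2 * real n)"] by simp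
  have 3: "cos (real (n - i) * pi / (2 * real n)) = sin (real i * pi / (2 * real n))"
  proof -
    have "real (n - i) * pi / (2 * real n) = pi / 2 - real i * pi / (2 * real n)"
      using assms by (simp add: of_nat_diff field_simps)
    then show ?thesis by (simp add: cos_diff)
  qed
  show ?thesis
  proof (cases "i = n")
    case True
    then show ?thesis using assms by (simp add: omegastar_def)
  next
    case False
    then show ?thesis unfolding omegastar_def 3 2 by simp
  qed
qed

lemma omegastar_pos:
  assumes "1 \<le> i" "i \<le> n"
  shows "omegastar n i > 0"
proof -
  have "cos (real i * pi / real n) < cos 0"
    using assms by (intro cos_monotone_0_pi) (auto simp: field_simps)
  then show ?thesis using assms by (simp add: omegastar_eq)
qed

lemma sum_omegastar:
  assumes "n \<ge> 1"
  shows "(\<Sum>i=1..n. omegastar n i * f i)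
       = (\<Sum>i<n. (1 - cos (real i * pi / real n)) * f i
                 + (1 - cos (real (Suc i) * pi / real n)) * f (Suc i)) / (2 * real n)"
proof -
  define g where "g i = (1 - cos (real i * pi / real n)) * f i" for i
  have "(\<Sum>i=1..n. omegastar n i * f i) = (\<Sum>i=1..n. g i / real n - (if i = n then g n / (2 * real n) else 0))"
    using assms by (intro sum.cong) (auto simp: omegastar_eq g_def field_simps)
  also have "\<dots> = (\<Sum>i=1..n. g i) / real n - g n / (2 * real n)"
    using assms by (simp add: sum_subtractf sum_divide_distrib)
  also have "(\<Sum>i=1..n. g i) = (\<Sum>i<n. g (Suc i))"
    by (simp add: sum.atLeast1_atMost_eq)
  \<comment> \<open>As \<open>g 0 = 0\<close>, it can be inserted freely; then
    \<open>g n - g 0\<close> telescopes and turns one of the two copies of the sum into the sum of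
    \<open>g i\<close>.\<close>
  also have "(\<Sum>i<n. g (Suc i)) / real n - g n / (2 * real n)
      = ((\<Sum>i<n. g (Suc i)) + ((\<Sum>i<n. g (Suc i)) - (g n - g 0))) / (2 * real n)"
    using assms by (simp add: g_def field_simps)
  also have "g n - g 0 = (\<Sum>i<n. g (Suc i) - g i)"
    by (simp add: sum_lessThan_telescope)
  finally show ?thesis
    by (simp add: sum_subtractf sum.distrib g_def add.commute)
qed

text \<open>The reflection \<open>i \<mapsto> n - i\<close> changes the sign of the cosine, so the
  cosines cancel in the trapezoidal sum.\<close>

lemma sum_omegastar_eq_1:
  assumes "n \<ge> 1"
  shows "(\<Sum>i=1..n. omegastar n i) = 1"
proof -
  define C where "C i = cos (real i * pi / real n)" for i
  have "C (n - i) = - C i" if "i \<le> n" for i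
  proof -
    have "real (n - i) * pi / real n = pi - real i * pi / real n"
      using that assms by (simp add: of_nat_diff field_simps)
    then show ?thesis by (simp add: C_def)
  qed
  then have "(\<Sum>i<n. C i) = (\<Sum>i<n. - C (Suc i))"
    by (subst sum.nat_diff_reindex[symmetric], intro sum.cong) (auto simp: Suc_diff_Suc)
  then have "(\<Sum>i<n. (1 - C i) * 1 + (1 - C (Suc i)) * 1) = 2 * real n"
    by (simp add: sum.distrib sum_subtractf sum_negf)
  then show ?thesis
    using sum_omegastar[OF assms, of "\<lambda>_. 1"] assms by (simp add: C_def)
qed

text \<open>The factor \<open>1 - cos\<close> of the weights is absorbed into the polynomial. This
  raises the degree to at most \<open>n - 1\<close>, the largest that the trapezoidal orthogonality
  allows.\<close>

lemma sum_omegastar_alternating_poly: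
  assumes n: "n \<ge> 2" and p: "degree p \<le> n - 2"
  shows "(\<Sum>i=1..n. omegastar n i * ((-1) ^ i * poly p (cos (real i * pi / real n)))) = 0"
proof -
  have "degree ([:1, -1:] * p) \<le> 1 + degree p"
    by (rule order_trans[OF degree_mult_le]) simp
  then have "alternating_trapezoid n (\<lambda>x. poly ([:1, -1:] * p) (cos x)) = 0"
    using n p by (intro alternating_trapezoid_poly_cos) simp
  then show ?thesis
    using n by (subst sum_omegastar)
      (simp_all add: alternating_trapezoid_def algebra_simps)
qed

lemma tstar_cos:
  "(tstar n b i + \<bar>b\<bar> / real n) / (1 + \<bar>b\<bar> / real n) = - cos (real i * pi / real n)"
proof -
  define \<beta> where "\<beta> = \<bar>b\<bar> / real n"
  have "1 + \<beta> > 0" unfolding \<beta>_def by (intro add_pos_nonneg) auto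
  then show ?thesis by (simp add: tstar_def \<beta>_def[symmetric] field_simps)
qed

lemma inj_on_tstar: "inj_on (tstar n b) {1..n}"
proof (rule inj_onI)
  fix i j assume ij: "i \<in> {1..n}" "j \<in> {1..n}" and eq: "tstar n b i = tstar n b j"
  have range: "0 \<le> real k * pi / real n \<and> real k * pi / real n \<le> pi" if "k \<in> {1..n}" for k
    using that by (simp add: field_simps)
  have "cos (real i * pi / real n) = cos (real j * pi / real n)"
    using tstar_cos[of n b i] tstar_cos[of n b j] unfolding eq by simp
  then have "real i * pi / real n = real j * pi / real n"
    using cos_inj_pi range[OF ij(1)] range[OF ij(2)] by blast
  then show "i = j" using ij by simp
qed

text \<open>The points increase with \<open>i\<close>. The last one is 1, and the bound on
  \<open>b\<close> says that the first one is at least -1.\<close>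

lemma abs_tstar_le_1:
  assumes n: "n \<ge> 2" and i: "i \<in> {1..n}"
    and b: "\<bar>b\<bar> \<le> real n * ((1 - cos (pi / real n)) / (1 + cos (pi / real n)))"
  shows "\<bar>tstar n b i\<bar> \<le> 1"
proof -
  define \<beta> where "\<beta> = \<bar>b\<bar> / real n"
  have \<beta>: "\<beta> \<ge> 0" by (simp add: \<beta>_def)
  have "cos (pi / real n) \<ge> 0"
    using n by (intro cos_ge_zero) (auto simp: field_simps intro: order_trans[of _ 0])
  moreover have "\<beta> \<le> (1 - cos (pi / real n)) / (1 + cos (pi / real n))"
    using b n by (simp add: \<beta>_def field_simps)
  ultimately have le: "(1 + \<beta>) * cos (pi / real n) + \<beta> \<le> 1"
    by (simp add: field_simps)
  have "cos (real i * pi / real n) \<le> cos (pi / real n)"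
    using i n by (intro cos_monotone_0_pi_le) (auto simp: field_simps)
  then have "(1 + \<beta>) * cos (real i * pi / real n) \<le> (1 + \<beta>) * cos (pi / real n)"
    using \<beta> by (intro mult_left_mono) auto
  moreover have "(1 + \<beta>) * cos (real i * pi / real n) \<ge> (1 + \<beta>) * - 1"
    using \<beta> by (intro mult_left_mono) auto
  ultimately show ?thesis
    using le \<beta> by (simp add: tstar_def \<beta>_def[symmetric] abs_le_iff algebra_simps)
qed

text \<open>The weights are first placed on the indices and then pushed forward along
  \<open>x\<close>; injectivity keeps them from merging.\<close>

lemma omegastar_pmf_exists:
  assumes n: "n \<ge> 1" and inj: "inj_on x {1..n}"
  shows "\<exists>\<xi>. set_pmf \<xi> = x ` {1..n} \<and> (\<forall>i\<in>{1..n}. pmf \<xi> (x i) = omegastar n i)"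
proof -
  define w where "w i = (if i \<in> {1..n} then omegastar n i else 0)" for i
  have w: "w i \<ge> 0" for i
    using omegastar_pos[of i n] by (auto simp: w_def)
  have "(\<integral>\<^sup>+i. ennreal (w i) \<partial>count_space UNIV) = (\<Sum>i\<in>{1..n}. ennreal (w i))"
    by (intro nn_integral_count_space') (auto simp: w_def)
  also have "\<dots> = ennreal (\<Sum>i\<in>{1..n}. w i)"
    using w by (intro sum_ennreal) auto
  also have "(\<Sum>i\<in>{1..n}. w i) = 1"
    using sum_omegastar_eq_1[OF n] by (simp add: w_def)
  finally have total: "(\<integral>\<^sup>+i. ennreal (w i) \<partial>count_space UNIV) = 1" by simp
  define \<zeta> where "\<zeta> = embed_pmf w"
  have pmf: "pmf \<zeta> i = w i" for i
    unfolding \<zeta>_def by (rule pmf_embed_pmf[OF w total])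
  have set: "set_pmf \<zeta> = {1..n}"
  proof -
    have "w i \<noteq> 0 \<longleftrightarrow> i \<in> {1..n}" for i
      using omegastar_pos[of i n] by (auto simp: w_def)
    then show ?thesis by (intro set_eqI) (simp only: set_pmf_iff pmf)
  qed
  have "pmf (map_pmf x \<zeta>) (x i) = omegastar n i" if "i \<in> {1..n}" for i
    using that inj by (subst pmf_map_inj) (auto simp: set pmf w_def)
  then show ?thesis by (intro exI[of _ "map_pmf x \<zeta>"]) (simp add: set)
qed

section \<open>The T-optimal design\<close>

theorem theorem3p2:
  fixes n :: nat and \<theta>\<^sub>1 :: "nat \<Rightarrow> real" and b :: real
  assumes "n \<ge> 2"
    and "\<theta>\<^sub>1 \<in> coeff_space n"
    and "\<theta>\<^sub>1 n \<noteq> 0"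
    and "b = \<theta>\<^sub>1 (n - 1) / \<theta>\<^sub>1 n"
    and "b \<noteq> 0"
    and "\<bar>b\<bar> \<le> real n * ((1 - cos (pi / real n)) / (1 + cos (pi / real n)))"
  shows "real n * ((1 - cos (pi / real n)) / (1 + cos (pi / real n))) = real n * (tan (pi / (2 * real n)))\<^sup>2 \<and>
         (\<exists>!\<xi>. T_optimal {-1..1} (poly_model n) \<theta>\<^sub>1 (poly_model (n - 2)) (coeff_space (n - 2)) \<xi>) \<and>
         (\<forall>\<xi>. T_optimal {-1..1} (poly_model n) \<theta>\<^sub>1 (poly_model (n - 2)) (coeff_space (n - 2)) \<xi> \<longrightarrow>
           (b > 0 \<longrightarrow> set_pmf \<xi> = tstar n b ` {1..n} \<and>
                      (\<forall>i\<in>{1..n}. pmf \<xi> (tstar n b i) = omegastar n i)) \<and>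
           (b < 0 \<longrightarrow> set_pmf \<xi> = (\<lambda>i. - tstar n b i) ` {1..n} \<and>
                      (\<forall>i\<in>{1..n}. pmf \<xi> (- tstar n b i) = omegastar n i)))"
proof -
  note n = assms(1) and \<theta>n = assms(3)
  define \<beta> where "\<beta> = \<bar>b\<bar> / real n"
  \<comment> \<open>The sign lets both cases of the theorem be treated at once, with support points
    \<open>\<sigma> * tstar n b i\<close>.\<close>
  define \<sigma> where "\<sigma> = sgn b"
  define a where "a = \<sigma> / (1 + \<beta>)"
  define c where "c = \<beta> / (1 + \<beta>)"
  \<comment> \<open>Chosen to give \<open>P\<close> the leading coefficient
    \<open>\<theta>\<^sub>1 n\<close>.\<close>
  define L where "L = \<theta>\<^sub>1 n / (2 ^ (n - 1) * a ^ n)"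
  define P where "P = smult L (affine_chebyshev a c n)"
  define x where "x i = \<sigma> * tstar n b i" for i
  have \<beta>: "\<beta> > 0" using n assms(5) by (simp add: \<beta>_def)
  have \<sigma>: "\<sigma> * \<sigma> = 1" "\<sigma> \<noteq> 0" "\<sigma> * \<bar>b\<bar> = b" "\<sigma> = 1 \<or> \<sigma> = -1"
    using assms(5) by (auto simp: \<sigma>_def sgn_if)
  have a: "a \<noteq> 0" using \<beta> \<sigma> by (simp add: a_def)
  have L: "L \<noteq> 0" using a \<theta>n by (simp add: L_def)
  have u: "a * y + c = (\<sigma> * y + \<beta>) / (1 + \<beta>)" for y
    by (simp add: a_def c_def add_divide_distrib)
  have ux: "a * x i + c = - cos (real i * pi / real n)" for i
    unfolding u x_def using tstar_cos[of n b i] \<sigma>(1) by (simp add: \<beta>_def flip: mult.assoc)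
  have P_poly: "poly P y = L * cos (real n * \<phi>)" if "a * y + c = cos \<phi>" for y \<phi>
    using poly_affine_chebyshev[OF that] by (simp add: P_def)
  \<comment> \<open>The angle belonging to \<open>x i\<close> is \<open>pi - i * pi / n\<close>,
    which is the source of the extra sign \<open>(-1) ^ n\<close>.\<close>
  have P_x: "poly P (x i) = L * (-1) ^ n * (-1) ^ i" for i
  proof -
    have "poly P (x i) = L * cos (real n * (pi - real i * pi / real n))"
      by (rule P_poly) (simp add: ux)
    also have "real n * (pi - real i * pi / real n) = real n * pi - real i * pi"
      using n by (simp add: field_simps)
    also have "cos \<dots> = (-1) ^ n * (-1) ^ i"
      by (simp add: cos_diff mult.commute[of _ pi])
    finally show ?thesis by simp
  qed

  obtain q where q: "degree q \<le> n" "\<And>x. poly_model n x \<theta>\<^sub>1 = poly q x"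
    "\<And>j. j \<le> n \<Longrightarrow> coeff q j = \<theta>\<^sub>1 j"
    using poly_model_as_poly by blast
  \<comment> \<open>The restriction loses nothing once the coefficients of \<open>q - P\<close> at
    \<open>n\<close> and \<open>n - 1\<close> are shown to vanish.\<close>
  define \<theta>\<^sub>0 where "\<theta>\<^sub>0 = restrict (coeff (q - P)) {0..n - 2}"
  have \<theta>\<^sub>0: "\<theta>\<^sub>0 \<in> coeff_space (n - 2)"
    by (auto simp: \<theta>\<^sub>0_def coeff_space_def)
  have "coeff (q - P) j = 0" if j: "j > n - 2" for j
  proof -
    obtain k where k: "n = Suc k" using n by (cases n) auto
    consider "j > n" | "j = n" | "j = k" using j k by linarith
    then show ?thesis
    proof cases
      case 1
      then have "coeff q j = 0" "coeff (affine_chebyshev a c n) j = 0"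
        using q(1) degree_affine_chebyshev[of a c n] by (auto intro!: coeff_eq_0)
      then show ?thesis by (simp add: P_def)
    next
      case 2
      then show ?thesis
        using coeff_affine_chebyshev[of a c k] a by (simp add: q P_def L_def k)
    next
      case 3
      \<comment> \<open>Here the shift \<beta> is matched to \<open>b\<close>: the ratio of the two
        top coefficients of \<open>P\<close> is
        \<open>n * c / a = \<sigma> * \<bar>b\<bar> = b\<close>.\<close>
      have "coeff P k = \<theta>\<^sub>1 n * real n * (c / a)"
        using coeff_affine_chebyshev[of a c k] a by (simp add: P_def L_def k)
      also have "c / a = \<sigma> * \<beta>"
        using \<sigma>(4) \<beta> by (elim disjE) (simp_all add: a_def c_def)
      also have "\<theta>\<^sub>1 n * real n * (\<sigma> * \<beta>) = \<theta>\<^sub>1 n * (\<sigma> * \<bar>b\<bar>)"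
        using n by (simp add: \<beta>_def)
      also have "\<dots> = \<theta>\<^sub>1 k"
        unfolding \<sigma>(3) using assms(4) \<theta>n k by simp
      finally show ?thesis using 3 by (simp add: q k)
    qed
  qed
  then have "degree (q - P) \<le> n - 2"
    by (intro degree_le) auto
  then have "poly (q - P) y = poly_model (n - 2) y \<theta>\<^sub>0" for y
    unfolding \<theta>\<^sub>0_def by (rule poly_eq_poly_model)
  then have residual: "poly P y = poly_model n y \<theta>\<^sub>1 - poly_model (n - 2) y \<theta>\<^sub>0" for y
    by (simp add: q flip: \<open>\<And>y. poly (q - P) y = _\<close>)

  \<comment> \<open>The affine map sends \<open>[-1, 1]\<close> into itself, so the cosine
    substitution is available at every point.\<close>
  have cos_ex: "\<exists>\<phi>. 0 \<le> \<phi> \<and> \<phi> \<le> pi \<and> a * y + c = cos \<phi>" if "y \<in> {-1..1}" for y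
  proof -
    have "\<bar>\<sigma> * y\<bar> \<le> 1" using \<sigma>(4) that by (elim disjE) (simp_all add: abs_le_iff)
    then have "- 1 \<le> a * y + c" "a * y + c \<le> 1"
      unfolding u using \<beta> by (simp_all add: field_simps abs_le_iff)
    then show ?thesis
      by (intro exI[of _ "arccos (a * y + c)"]) (simp add: arccos_lbound arccos_ubound)
  qed
  have bound: "(poly P y)\<^sup>2 \<le> L\<^sup>2" if y: "y \<in> {-1..1}" for y
  proof -
    obtain \<phi> where "a * y + c = cos \<phi>" using cos_ex[OF y] by blast
    then show ?thesis
      using abs_cos_le_one[of "real n * \<phi>"]
      by (simp add: P_poly power_mult_distrib mult_left_le abs_square_le_1)
  qed
  have extremal: "y \<in> x ` {1..n}" if y: "y \<in> {-1..1}" and eq: "(poly P y)\<^sup>2 = L\<^sup>2" for y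
  proof -
    obtain \<phi> where \<phi>: "0 \<le> \<phi>" "\<phi> \<le> pi" "a * y + c = cos \<phi>" using cos_ex[OF y] by blast
    have "(cos (real n * \<phi>))\<^sup>2 = 1"
      using eq L by (simp add: P_poly[OF \<phi>(3)] power_mult_distrib)
    then have "sin (real n * \<phi>) = 0"
      by (simp add: cos_squared_eq)
    then obtain j :: int where j: "real n * \<phi> = of_int j * pi"
      by (auto simp: sin_zero_iff_int2)
    have "0 \<le> of_int j * pi" "of_int j * pi \<le> real n * pi"
      using \<phi> n unfolding j[symmetric] by (auto intro: mult_left_mono)
    then have "0 \<le> j" and jn: "of_int j \<le> real n"
      using pi_gt_zero by (simp_all add: zero_le_mult_iff)
    then obtain m where m: "j = int m" using nonneg_int_cases by blast
    \<comment> \<open>The index is reversed because \<open>m * pi / n\<close> must equal the angle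
      \<open>pi - i * pi / n\<close> of \<open>x i\<close>.\<close>
    define i where "i = n - m"
    have mn: "m \<le> n" using jn by (simp add: m)
    then have i: "i \<le> n" "real i = real n - real m" by (auto simp: i_def of_nat_diff)
    have "\<phi> = real m * pi / real n"
      using j n by (simp add: m nonzero_eq_divide_eq mult.commute)
    also have "\<dots> = pi - real i * pi / real n"
      using n by (simp add: i(2) left_diff_distrib diff_divide_distrib)
    finally have "\<phi> = pi - real i * pi / real n" .
    then have "a * y + c = a * x i + c" by (simp add: \<phi>(3) ux)
    then have yx: "y = x i" using a by simp
    \<comment> \<open>The extremal point of index 0 would lie at distance
      \<open>1 + 2 * \<beta>\<close> from the origin, outside the interval.\<close>
    have "i \<noteq> 0"
    proof
      assume "i = 0"
      then have "\<sigma> * y = - 1 - 2 * \<beta>"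
        using \<sigma>(1) by (simp add: yx x_def tstar_def \<beta>_def flip: mult.assoc)
      then show False using \<sigma>(4) y \<beta> by (elim disjE) simp_all
    qed
    then show ?thesis using yx i by auto
  qed

  have inj: "inj_on x {1..n}"
  proof (rule inj_onI)
    fix i j assume ij: "i \<in> {1..n}" "j \<in> {1..n}" and "x i = x j"
    then have "tstar n b i = tstar n b j" using \<sigma>(2) by (simp add: x_def)
    then show "i = j" using inj_onD[OF inj_on_tstar] ij by blast
  qed
  have n1: "n \<ge> 1" using n by simp
  obtain \<xi>\<^sub>0 where support: "set_pmf \<xi>\<^sub>0 = x ` {1..n}"
    and weight: "\<forall>i\<in>{1..n}. pmf \<xi>\<^sub>0 (x i) = omegastar n i"
    using omegastar_pmf_exists[OF n1 inj] by blast
  have E: "measure_pmf.expectation \<xi>\<^sub>0 f = (\<Sum>i=1..n. omegastar n i * f (x i))" for f :: "real \<Rightarrow> real"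
  proof -
    have "measure_pmf.expectation \<xi>\<^sub>0 f = (\<Sum>y\<in>x ` {1..n}. f y * pmf \<xi>\<^sub>0 y)"
      by (intro integral_measure_pmf_real) (simp_all add: support)
    also have "\<dots> = (\<Sum>i=1..n. f (x i) * pmf \<xi>\<^sub>0 (x i))"
      by (simp only: sum.reindex[OF inj] comp_def)
    also have "\<dots> = (\<Sum>i=1..n. omegastar n i * f (x i))"
      using weight by (intro sum.cong) simp_all
    finally show ?thesis .
  qed
  have "x i \<in> {-1..1}" if "i \<in> {1..n}" for i
  proof -
    have "\<bar>\<sigma>\<bar> = 1" using \<sigma>(4) by (elim disjE) simp_all
    then have "\<bar>x i\<bar> \<le> 1"
      using abs_tstar_le_1[OF n that assms(6)] by (simp only: x_def abs_mult mult_1)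
    then show ?thesis by (simp add: abs_le_iff)
  qed
  then have design: "is_design {-1..1} \<xi>\<^sub>0"
    unfolding is_design_def support by blast
  have equi: "equioscillating (n - 2) (poly P) (L\<^sup>2) \<xi>\<^sub>0"
    unfolding equioscillating_def
  proof (intro conjI ballI allI impI)
    show "(poly P y)\<^sup>2 = L\<^sup>2" if y: "y \<in> set_pmf \<xi>\<^sub>0" for y
    proof -
      obtain i where "y = x i" using y support by blast
      then have "\<bar>poly P y\<bar> = \<bar>L\<bar>" by (simp add: P_x abs_mult power_abs)
      then show ?thesis by (simp only: power2_eq_iff abs_eq_iff)
    qed
  next
    fix p :: "real poly" assume p: "degree p \<le> n - 2"
    \<comment> \<open>This is \<open>p\<close> in the variable \<open>cos (i * pi / n)\<close>,
      obtained by solving \<open>a * y + c = - cos (i * pi / n)\<close> for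
      \<open>y\<close>.\<close>
    define p' where "p' = p \<circ>\<^sub>p [:- c / a, - 1 / a:]"
    have "degree p' \<le> n - 2"
      using p a by (simp add: p'_def degree_pcompose)
    moreover have "poly p (x i) = poly p' (cos (real i * pi / real n))" for i
    proof -
      have "x i = - c / a + cos (real i * pi / real n) * (- 1 / a)"
        using ux[of i] a by (simp add: field_simps)
      then show ?thesis by (simp add: p'_def poly_pcompose)
    qed
    moreover have "measure_pmf.expectation \<xi>\<^sub>0 (\<lambda>y. poly P y * poly p y)
        = L * (-1) ^ n * (\<Sum>i=1..n. omegastar n i * ((-1) ^ i * poly p (x i)))"
      by (simp add: E P_x sum_distrib_left mult_ac)
    ultimately show "measure_pmf.expectation \<xi>\<^sub>0 (\<lambda>y. poly P y * poly p y) = 0"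
      using sum_omegastar_alternating_poly[OF n] by simp
  qed

  have iff: "T_optimal {-1..1} (poly_model n) \<theta>\<^sub>1 (poly_model (n - 2)) (coeff_space (n - 2)) \<xi>
      \<longleftrightarrow> \<xi> = \<xi>\<^sub>0" for \<xi>
  proof -
    \<comment> \<open>Any such design lives on the same \<open>n = (n - 2) + 2\<close> points,
      exactly the number for which the weights are determined.\<close>
    have unique: "\<xi> = \<xi>\<^sub>0" if "is_design {-1..1} \<xi>" "equioscillating (n - 2) (poly P) (L\<^sup>2) \<xi>"
    proof (rule equioscillating_unique)
      show "card (x ` {1..n}) = n - 2 + 2" using card_image[OF inj] n by simp
      show "set_pmf \<xi> \<subseteq> x ` {1..n}"
        using that extremal by (auto simp: is_design_def equioscillating_def)
      show "poly P y \<noteq> 0" if "y \<in> x ` {1..n}" for y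
        using that L by (auto simp: P_x)
    qed (use that equi support in simp_all)
    have "T_optimal {-1..1} (poly_model n) \<theta>\<^sub>1 (poly_model (n - 2)) (coeff_space (n - 2)) \<xi>
        \<longleftrightarrow> is_design {-1..1} \<xi> \<and> equioscillating (n - 2) (poly P) (L\<^sup>2) \<xi>"
      by (rule T_optimal_iff_equioscillating[OF _ \<theta>\<^sub>0 _ design equi]) (fact residual bound)+
    then show ?thesis using unique design equi by blast
  qed

  have tan: "(1 - cos (pi / real n)) / (1 + cos (pi / real n)) = (tan (pi / (2 * real n)))\<^sup>2"
  proof -
    have *: "pi / real n = 2 * (pi / (2 * real n))" by simp
    have "1 - cos (pi / real n) = 2 * (sin (pi / (2 * real n)))\<^sup>2"
      unfolding * cos_double_sin by simp
    moreover have "1 + cos (pi / real n) = 2 * (cos (pi / (2 * real n)))\<^sup>2"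
      unfolding * cos_double_cos by simp
    ultimately show ?thesis by (simp add: tan_def power_divide)
  qed
  show ?thesis
  proof (cases "b > 0")
    case True
    then have "tstar n b = x" by (simp add: fun_eq_iff x_def \<sigma>_def)
    then show ?thesis unfolding iff tan using True support weight by simp
  next
    case False
    then have neg: "b < 0" using assms(5) by simp
    then have "(\<lambda>i. - tstar n b i) = x" by (simp add: fun_eq_iff x_def \<sigma>_def)
    moreover from this have "- tstar n b i = x i" for i by (rule fun_cong)
    ultimately show ?thesis unfolding iff tan using neg support weight by simp
  qed
qed

end
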